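(* Let $G$ be a finite group and let $R$ be an integral domain with $1$ of characteristic $p\geq 0$ such that $p$ does not divide the order of $G$. Let $RG$ be the group ring of $G$ over $R$, with center $\mathcal{Z}(RG)$. (i) If $R$ is a field and $\sigma,\tau$ are $R$-algebra endomorphisms of $RG$ that fix $\mathcal{Z}(RG)$ elementwise, then every $(\sigma,\tau)$-derivation of $RG$ is $(\sigma,\tau)$-inner. (ii) If $R$ is an integral domain that is not a field and $\sigma,\tau: RG\to RG$ are $R$-linear extensions of group homomorphisms $G\to G$ such that $\sigma$ and $\tau$ fix $\mathcal{Z}(RG)$ elementwise, then every $(\sigma,\tau)$-derivation of $RG$ is $(\sigma,\tau)$-inner.
   Context: Let $R$ be a commutative ring with $1$, $\mathcal{A}$ an (associative) algebra over $R$, and $\sigma,\tau$ algebra endomorphisms of $\mathcal{A}$ (not necessarily distinct). A $(\sigma,\tau)$-derivation on $\mathcal{A}$ is an $R$-linear map $\delta:\mathcal{A}\to\mathcal{A}$ satisfying $\delta(ab)=\delta(a)\tau(b)+\sigma(a)\delta(b)$ for all $a,b\in\mathcal{A}$. A $(\sigma,\tau)$-derivation $\delta$ is called $(\sigma,\tau)$-inner if there is $x\in\mathcal{A}$ such that $\delta(a)=x\tau(a)-\sigma(a)x$ for all $a\in\mathcal{A}$. $\mathcal{Z}(\mathcal{A})$ denotes the center of $\mathcal{A}$, and "fixes $\mathcal{Z}(\mathcal{A})$ elementwise" means $\sigma(z)=z$ (resp. $\tau(z)=z$) for all $z\in\mathcal{Z}(\mathcal{A})$. When $p=0$, the condition that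 $p$ does not divide $|G|$ holds automatically. *)

theory Defs
  imports Complex_Main "HOL-Library.Poly_Mapping" "HOL-Library.Cardinality"
begin

text \<open>
  A commutative ring is a type of class \<open>comm_ring_1\<close>, an (associative) \<open>R\<close>-algebra is a type of
  class \<open>ring\<close> together with a scalar multiplication. That the latter is a module structure is
  part of the library locale \<open>module_hom\<close>, by which \<open>R\<close>-linearity is expressed; compatibility with
  multiplication is proved for the group ring below.
\<close>

definition algebra_endo :: "('r::comm_ring_1 \<Rightarrow> 'a::ring \<Rightarrow> 'a) \<Rightarrow> ('a \<Rightarrow> 'a) \<Rightarrow> bool"
  \<comment> \<open>Preservation of a unit is not demanded; it is automatic for maps fixing the center.\<close>
  where "algebra_endo scale \<sigma> \<longleftrightarrow>
    module_hom scale scale \<sigma> \<and> (\<forall>a b. \<sigma> (a * b) = \<sigma> a * \<sigma> b)"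

definition twisted_derivation ::
  "('r::comm_ring_1 \<Rightarrow> 'a::ring \<Rightarrow> 'a) \<Rightarrow> ('a \<Rightarrow> 'a) \<Rightarrow> ('a \<Rightarrow> 'a) \<Rightarrow> ('a \<Rightarrow> 'a) \<Rightarrow> bool"
  where "twisted_derivation scale \<sigma> \<tau> \<delta> \<longleftrightarrow>
    module_hom scale scale \<delta> \<and> (\<forall>a b. \<delta> (a * b) = \<delta> a * \<tau> b + \<sigma> a * \<delta> b)"

definition twisted_inner ::
  "('a::ring \<Rightarrow> 'a) \<Rightarrow> ('a \<Rightarrow> 'a) \<Rightarrow> ('a \<Rightarrow> 'a) \<Rightarrow> bool"
  where "twisted_inner \<sigma> \<tau> \<delta> \<longleftrightarrow> (\<exists>x. \<forall>a. \<delta> a = x * \<tau> a - \<sigma> a * x)"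

definition center :: "'a::ring set"
  where "center = {z. \<forall>a. z * a = a * z}"

definition is_field :: "'r::idom itself \<Rightarrow> bool"
  where "is_field _ \<longleftrightarrow> (\<forall>a::'r. a \<noteq> 0 \<longrightarrow> (\<exists>b. a * b = 1))"

text \<open>
  The group ring \<open>RG\<close> is the type \<open>'g \<Rightarrow>\<^sub>0 'r\<close> of finitely supported functions \<open>G \<rightarrow> R\<close> with the
  convolution product of \<open>Poly_Mapping\<close>. The group \<open>G\<close> is a type of class \<open>group_add\<close>, whose
  operation is written \<open>+\<close> but is not assumed commutative. A group element \<open>g\<close> is
  \<open>Poly_Mapping.single g 1\<close> in \<open>RG\<close>.
\<close>

definition gr_scale :: "'r::comm_ring_1 \<Rightarrow> ('g::group_add \<Rightarrow>\<^sub>0 'r) \<Rightarrow> ('g \<Rightarrow>\<^sub>0 'r)"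
  where "gr_scale c f = Poly_Mapping.map ((*) c) f"

definition group_endo :: "('g::group_add \<Rightarrow> 'g) \<Rightarrow> bool"
  where "group_endo \<phi> \<longleftrightarrow> (\<forall>g h. \<phi> (g + h) = \<phi> g + \<phi> h)"

definition linear_extension ::
  "('g::group_add \<Rightarrow> 'g) \<Rightarrow> (('g \<Rightarrow>\<^sub>0 'r::comm_ring_1) \<Rightarrow> ('g \<Rightarrow>\<^sub>0 'r)) \<Rightarrow> bool"
  where "linear_extension \<phi> \<sigma> \<longleftrightarrow>
    module_hom gr_scale gr_scale \<sigma> \<and>
    (\<forall>g. \<sigma> (Poly_Mapping.single g 1) = Poly_Mapping.single (\<phi> g) 1)"

lemma lookup_gr_scale: "Poly_Mapping.lookup (gr_scale c f) g = c * Poly_Mapping.lookup f g"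
  by (simp add: gr_scale_def map.rep_eq when_def)

lemma gr_induct [case_names single sum]:
  fixes f :: "'g \<Rightarrow>\<^sub>0 'r::comm_ring_1"
  assumes single: "\<And>g c. P (Poly_Mapping.single g c)" and sum: "\<And>f h. P f \<Longrightarrow> P h \<Longrightarrow> P (f + h)"
  shows "P f"
proof (induction f rule: update_induct)
  case const
  show ?case using single[of _ 0] by simp
next
  case (update f g c)
  have "Poly_Mapping.update g c f = f + Poly_Mapping.single g c"
    using update by (intro poly_mapping_eqI)
      (auto simp: lookup_update lookup_add lookup_single when_def in_keys_iff)
  with update single sum show ?case by simp
qed

lemma gr_scale_eq: "gr_scale c f = Poly_Mapping.single 0 c * f"
proof (induction f rule: gr_induct)
  case (single g a)
  show ?case
    by (rule poly_mapping_eqI) (simp add: lookup_gr_scale mult_single lookup_single when_def)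
next
  case (sum f h)
  have "gr_scale c (f + h) = gr_scale c f + gr_scale c h" for f h :: "'a \<Rightarrow>\<^sub>0 'b"
    by (rule poly_mapping_eqI) (simp add: lookup_gr_scale lookup_add algebra_simps)
  with sum show ?case by (simp add: algebra_simps)
qed

lemma module_gr_scale: "module gr_scale"
  by standard (auto intro!: poly_mapping_eqI simp: lookup_gr_scale lookup_add algebra_simps)

lemma gr_scale_mult_left: "gr_scale c (a * b) = gr_scale c a * b"
  by (simp add: gr_scale_eq mult.assoc)

lemma gr_scale_mult_right: "gr_scale c (a * b) = a * gr_scale c b"
proof -
  have "Poly_Mapping.single 0 c * a = a * Poly_Mapping.single 0 c"
  proof (induction a rule: gr_induct)
    case (single g d)
    show ?case by (simp add: mult_single mult.commute)
  next
    case (sum f h)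
    then show ?case by (simp add: algebra_simps)
  qed
  then show ?thesis by (metis gr_scale_eq mult.assoc)
qed

lemma linear_extension_algebra_endo:
  assumes "group_endo \<phi>" and ext: "linear_extension \<phi> \<sigma>"
  shows "algebra_endo gr_scale \<sigma>"
proof -
  interpret module_hom gr_scale gr_scale \<sigma>
    using ext by (simp add: linear_extension_def)
  have S: "Poly_Mapping.single g c = gr_scale c (Poly_Mapping.single g 1)" for g :: 'a and c :: 'b
    by (simp add: gr_scale_eq mult_single)
  have \<sigma>S: "\<sigma> (Poly_Mapping.single g c) = Poly_Mapping.single (\<phi> g) c" for g c
    using ext by (subst S, subst scale) (simp add: linear_extension_def S[symmetric])
  have "\<sigma> (a * b) = \<sigma> a * \<sigma> b" for a b
  proof (induction a rule: gr_induct)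
    case (single g c)
    show ?case
    proof (induction b rule: gr_induct)
      case (single h d)
      show ?case using assms(1) by (simp add: mult_single \<sigma>S group_endo_def)
    next
      case (sum f h)
      then show ?case by (simp add: distrib_left add)
    qed
  next
    case (sum f h)
    then show ?case by (simp add: distrib_right add)
  qed
  then show ?thesis
    using module_hom_axioms by (simp add: algebra_endo_def)
qed

end

theory Submission
  imports Defs
begin

text \<open>
  If \<open>n = |G|\<close> is invertible, then \<open>x = n\<^sup>-\<^sup>1 \<Sum>g. \<delta>(g) \<tau>(g\<^sup>-\<^sup>1)\<close> realises \<open>\<delta>\<close> as inner. If it is merely
  nonzero and \<open>\<sigma>, \<tau>\<close> come from group endomorphisms \<open>\<phi>, \<psi>\<close>, then the coefficients of
  \<open>\<delta>(g) \<tau>(g\<^sup>-\<^sup>1)\<close> form a 1-cocycle with values in the functions on the \<open>G\<close>-set \<open>G\<close> with right action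
  \<open>x \<mapsto> \<phi>(g)\<^sup>-\<^sup>1 x \<psi>(g)\<close>. Averaging shows that \<open>n\<close> times this cocycle is the coboundary of some \<open>w\<close>;
  subtracting from \<open>w\<close> its value at a representative of each orbit makes it divisible by \<open>n\<close>, so the
  cocycle itself is a coboundary.
\<close>

lemma sum_group_shift:
  fixes f :: "'g::{group_add,finite} \<Rightarrow> 'a::comm_monoid_add"
  shows "(\<Sum>h\<in>UNIV. f (g + h)) = (\<Sum>h\<in>UNIV. f h)"
  by (rule sum.reindex_bij_witness[where i = "\<lambda>h. - g + h" and j = "\<lambda>h. g + h"])
    (simp_all add: add.assoc[symmetric])

text \<open>The values of the averaged function \<open>w\<close> differ along an orbit by multiples
  of \<open>|G|\<close>, so the division is done by exhibiting the quotient. Only cancellation in a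
  domain is then required.\<close>

lemma permutation_cocycle_is_coboundary:
  fixes c :: "'g::{group_add,finite} \<Rightarrow> 'x \<Rightarrow> 'r::idom" and act :: "'g \<Rightarrow> 'x \<Rightarrow> 'x"
  assumes act_0: "\<And>x. act 0 x = x"
    and act_add: "\<And>g h x. act (g + h) x = act h (act g x)"
    and cocycle: "\<And>g h x. c (g + h) x = c g x + c h (act g x)"
    and card: "of_nat CARD('g) \<noteq> (0 :: 'r)"
  obtains v where "\<And>g x. c g x = v x - v (act g x)"
proof -
  let ?n = "of_nat CARD('g) :: 'r"
  define w where "w x = (\<Sum>g\<in>UNIV. c g x)" for x
  \<comment> \<open>Sum the cocycle identity over \<open>h\<close> with \<open>g\<close> fixed; the
    left side becomes \<open>w x\<close> by translation invariance.\<close>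
  have avg: "?n * c g x = w x - w (act g x)" for g x
    using sum_group_shift[of "\<lambda>h. c h x" g] by (simp add: w_def cocycle sum.distrib algebra_simps)
  define orb where "orb x = range (\<lambda>g. act g x)" for x
  \<comment> \<open>The choice depends on the set \<open>orb x\<close> alone, so points of one orbit
    share their representative.\<close>
  define rep where "rep x = (SOME y. y \<in> orb x)" for x
  have orb: "orb (act g x) = orb x" for g x
  proof
    show "orb (act g x) \<subseteq> orb x"
      by (auto simp: orb_def act_add[symmetric])
    have "act h x = act (- g + h) (act g x)" for h
      by (simp add: act_add[symmetric] add.assoc[symmetric])
    then show "orb x \<subseteq> orb (act g x)"
      unfolding orb_def by (blast intro: range_eqI)
  qed
  have "rep x \<in> orb x" for x
    unfolding rep_def by (rule someI[of _ "act 0 x"]) (simp add: orb_def)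
  then have "\<exists>k. rep x = act k x" for x
    by (auto simp: orb_def)
  then obtain k where k: "\<And>x. rep x = act (k x) x"
    by metis
  \<comment> \<open>By \<open>avg\<close> at \<open>g = k x\<close>, this is the quotient of
    \<open>w x - w (rep x)\<close> by \<open>|G|\<close>.\<close>
  define v where "v x = c (k x) x" for x
  have v: "?n * v x = w x - w (rep x)" for x
    by (simp add: v_def avg k)
  have "?n * c g x = ?n * (v x - v (act g x))" for g x
    by (simp add: avg right_diff_distrib v) (simp add: rep_def orb)
  with card that show thesis
    by simp
qed

lemma single_eq_gr_scale:
  "Poly_Mapping.single g c = gr_scale c (Poly_Mapping.single g (1 :: 'r::comm_ring_1))"
  by (simp add: gr_scale_eq mult_single)

lemma lookup_single_times:
  fixes f :: "'g::group_add \<Rightarrow>\<^sub>0 'r::comm_ring_1"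
  shows "Poly_Mapping.lookup (Poly_Mapping.single g 1 * f) x = Poly_Mapping.lookup f (- g + x)"
proof (induction f rule: gr_induct)
  case (single h c)
  have "g + h = x \<longleftrightarrow> h = - g + x"
    by (metis add_minus_cancel minus_add_cancel)
  then show ?case by (simp add: mult_single lookup_single)
next
  case (sum f h)
  then show ?case by (simp add: distrib_left lookup_add)
qed

lemma lookup_times_single:
  fixes f :: "'g::group_add \<Rightarrow>\<^sub>0 'r::comm_ring_1"
  shows "Poly_Mapping.lookup (f * Poly_Mapping.single g 1) x = Poly_Mapping.lookup f (x - g)"
proof (induction f rule: gr_induct)
  case (single h c)
  have "h + g = x \<longleftrightarrow> h = x - g"
    by (metis add_diff_cancel diff_add_cancel)
  then show ?case by (simp add: mult_single lookup_single)
next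
  case (sum f h)
  then show ?case by (simp add: distrib_right lookup_add)
qed

lemma group_endo_zero: "group_endo \<phi> \<Longrightarrow> \<phi> 0 = 0"
  unfolding group_endo_def by (metis add.right_neutral add_left_cancel)

text \<open>Both sides of the inner formula are linear in the argument, and the group elements span
  the group ring.\<close>

lemma twisted_inner_if_on_group:
  fixes \<sigma> \<tau> \<delta> :: "('g::group_add \<Rightarrow>\<^sub>0 'r::comm_ring_1) \<Rightarrow> ('g \<Rightarrow>\<^sub>0 'r)"
  assumes "module_hom gr_scale gr_scale \<sigma>" "module_hom gr_scale gr_scale \<tau>"
    and "module_hom gr_scale gr_scale \<delta>"
    and group: "\<And>g. \<delta> (Poly_Mapping.single g 1)
      = x * \<tau> (Poly_Mapping.single g 1) - \<sigma> (Poly_Mapping.single g 1) * x"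
  shows "twisted_inner \<sigma> \<tau> \<delta>"
proof -
  interpret s: module_hom gr_scale gr_scale \<sigma> by fact
  interpret t: module_hom gr_scale gr_scale \<tau> by fact
  interpret d: module_hom gr_scale gr_scale \<delta> by fact
  have "\<delta> a = x * \<tau> a - \<sigma> a * x" for a
  proof (induction a rule: gr_induct)
    case (single g c)
    show ?case
      unfolding single_eq_gr_scale[of g c] d.scale s.scale t.scale group
      by (simp add: gr_scale_mult_left[symmetric] gr_scale_mult_right[symmetric]
          s.m1.scale_right_diff_distrib)
  next
    case (sum f h)
    then show ?case by (simp add: d.add s.add t.add algebra_simps)
  qed
  then show ?thesis
    unfolding twisted_inner_def by blast
qed

text \<open>An averaging argument as in Maschke's theorem. Unitality of \<open>\<tau>\<close> makes
  \<open>\<tau> (?e (- g))\<close> a right inverse of \<open>\<tau> (?e g)\<close>.\<close>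

lemma twisted_inner_if_card_unit:
  fixes \<sigma> \<tau> \<delta> :: "('g::{group_add,finite} \<Rightarrow>\<^sub>0 'r::comm_ring_1) \<Rightarrow> ('g \<Rightarrow>\<^sub>0 'r)"
  assumes \<sigma>: "algebra_endo gr_scale \<sigma>" and \<tau>: "algebra_endo gr_scale \<tau>" and "\<tau> 1 = 1"
    and \<delta>: "twisted_derivation gr_scale \<sigma> \<tau> \<delta>"
    and b: "of_nat CARD('g) * b = (1 :: 'r)"
  shows "twisted_inner \<sigma> \<tau> \<delta>"
proof -
  let ?e = "\<lambda>g. Poly_Mapping.single g 1 :: 'g \<Rightarrow>\<^sub>0 'r"
  have e_add: "?e (g + h) = ?e g * ?e h" for g h
    by (simp add: mult_single)
  have \<tau>_mult: "\<tau> (a * b) = \<tau> a * \<tau> b" for a b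
    using \<tau> by (simp add: algebra_endo_def)
  have \<delta>_mult: "\<delta> (a * b) = \<delta> a * \<tau> b + \<sigma> a * \<delta> b" for a b
    using \<delta> by (simp add: twisted_derivation_def)
  have \<tau>_inv: "\<tau> (?e g) * \<tau> (?e (- g)) = 1" for g
    using \<open>\<tau> 1 = 1\<close> by (simp add: \<tau>_mult[symmetric] mult_single)
  define y where "y = (\<Sum>g\<in>UNIV. \<delta> (?e g) * \<tau> (?e (- g)))"
  have y: "of_nat CARD('g) * \<delta> (?e h) = y * \<tau> (?e h) - \<sigma> (?e h) * y" for h
  proof -
    \<comment> \<open>This is the derivation rule at \<open>h + g\<close>, multiplied on the right
      by \<open>\<tau> (?e (- g))\<close>. Summed over \<open>g\<close>, its first term on the right
      becomes \<open>y * \<tau> (?e h)\<close> after translation by \<open>h\<close>.\<close>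
    have "\<sigma> (?e h) * \<delta> (?e g) * \<tau> (?e (- g))
        = \<delta> (?e (h + g)) * \<tau> (?e (- (h + g))) * \<tau> (?e h) - \<delta> (?e h)" for g
    proof -
      have "?e (- g) = ?e (- (h + g)) * ?e h"
        by (simp add: mult_single minus_add add.assoc)
      then have "\<delta> (?e (h + g)) * \<tau> (?e (- (h + g))) * \<tau> (?e h) = \<delta> (?e (h + g)) * \<tau> (?e (- g))"
        by (simp only: \<tau>_mult mult.assoc)
      also have "\<dots> = \<delta> (?e h) + \<sigma> (?e h) * \<delta> (?e g) * \<tau> (?e (- g))"
        by (simp only: e_add \<delta>_mult distrib_right mult.assoc \<tau>_inv mult_1_right)
      finally show ?thesis by simp
    qed
    then have "\<sigma> (?e h) * y
        = (\<Sum>g\<in>UNIV. \<delta> (?e (h + g)) * \<tau> (?e (- (h + g))) * \<tau> (?e h) - \<delta> (?e h))"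
      unfolding y_def sum_distrib_left by (simp only: mult.assoc)
    also have "\<dots> = y * \<tau> (?e h) - of_nat CARD('g) * \<delta> (?e h)"
      unfolding y_def sum_distrib_right
        sum_group_shift[of "\<lambda>g. \<delta> (?e g) * \<tau> (?e (- g)) * \<tau> (?e h)" h, symmetric]
      by (simp only: sum_subtractf sum_constant)
    finally show ?thesis by simp
  qed
  \<comment> \<open>The natural number multiplies in the group ring as its image in the coefficient
    ring does, so scaling by \<open>b\<close> undoes it.\<close>
  have unit: "gr_scale b (of_nat CARD('g) * a) = a" for a :: "'g \<Rightarrow>\<^sub>0 'r"
  proof -
    have "of_nat n * a = gr_scale (of_nat n) a" for n
      by (induction n)
        (auto intro!: poly_mapping_eqI simp: lookup_gr_scale lookup_add algebra_simps)
    then show ?thesis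
      using b by (auto intro!: poly_mapping_eqI simp: lookup_gr_scale mult.assoc[symmetric] mult.commute)
  qed
  have "\<delta> (?e g) = gr_scale b y * \<tau> (?e g) - \<sigma> (?e g) * gr_scale b y" for g
  proof -
    interpret m: module "gr_scale :: 'r \<Rightarrow> ('g \<Rightarrow>\<^sub>0 'r) \<Rightarrow> _"
      by (rule module_gr_scale)
    show ?thesis
      using arg_cong[OF y, of "gr_scale b" g]
      by (simp add: unit m.scale_right_diff_distrib gr_scale_mult_left[symmetric]
          gr_scale_mult_right[symmetric])
  qed
  with \<sigma> \<tau> \<delta> show ?thesis
    by (intro twisted_inner_if_on_group) (auto simp: algebra_endo_def twisted_derivation_def)
qed

lemma twisted_inner_if_linear_extension:
  fixes \<sigma> \<tau> \<delta> :: "('g::{group_add,finite} \<Rightarrow>\<^sub>0 'r::idom) \<Rightarrow> ('g \<Rightarrow>\<^sub>0 'r)"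
  assumes \<phi>: "group_endo \<phi>" "linear_extension \<phi> \<sigma>"
    and \<psi>: "group_endo \<psi>" "linear_extension \<psi> \<tau>"
    and \<delta>: "twisted_derivation gr_scale \<sigma> \<tau> \<delta>"
    and card: "of_nat CARD('g) \<noteq> (0 :: 'r)"
  shows "twisted_inner \<sigma> \<tau> \<delta>"
proof -
  let ?e = "\<lambda>g. Poly_Mapping.single g 1 :: 'g \<Rightarrow>\<^sub>0 'r"
  have \<phi>_add: "\<phi> (g + h) = \<phi> g + \<phi> h" and \<psi>_add: "\<psi> (g + h) = \<psi> g + \<psi> h" for g h
    using \<phi>(1) \<psi>(1) by (simp_all add: group_endo_def)
  have \<sigma>_e: "\<sigma> (?e g) = ?e (\<phi> g)" and \<tau>_e: "\<tau> (?e g) = ?e (\<psi> g)" for g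
    using \<phi>(2) \<psi>(2) by (simp_all add: linear_extension_def)
  have "\<delta> (?e g * ?e h) = \<delta> (?e g) * ?e (\<psi> h) + ?e (\<phi> g) * \<delta> (?e h)" for g h
    using \<delta> by (simp only: twisted_derivation_def \<sigma>_e \<tau>_e)
  then have \<delta>_add: "\<delta> (?e (g + h)) = \<delta> (?e g) * ?e (\<psi> h) + ?e (\<phi> g) * \<delta> (?e h)" for g h
    by (simp add: mult_single)
  \<comment> \<open>The coefficient of \<open>\<sigma> (?e g) * f * \<tau> (?e (- g))\<close> at
    \<open>x\<close> is that of \<open>f\<close> at \<open>act g x\<close>, and \<open>c g x\<close>
    is the coefficient of \<open>\<delta> (?e g) * \<tau> (?e (- g))\<close> at \<open>x\<close>.
    The derivation rule thus turns into the cocycle identity.\<close>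
  define act where "act g x = - \<phi> g + x + \<psi> g" for g x
  define c where "c g x = Poly_Mapping.lookup (\<delta> (?e g)) (x + \<psi> g)" for g x
  obtain v where v: "\<And>g x. c g x = v x - v (act g x)"
  proof (rule permutation_cocycle_is_coboundary[of act c])
    show "act 0 x = x" for x
      using \<phi>(1) \<psi>(1) by (simp add: act_def group_endo_zero)
    show "act (g + h) x = act h (act g x)" for g h x
      by (simp only: act_def \<phi>_add \<psi>_add minus_add add.assoc)
    show "c (g + h) x = c g x + c h (act g x)" for g h x
      by (simp add: c_def act_def \<delta>_add lookup_add lookup_single_times lookup_times_single
          \<psi>_add add.assoc[symmetric])
  qed (use card in auto)
  \<comment> \<open>As the group is finite, every function on it has finite support.\<close>
  define y where "y = Abs_poly_mapping v"
  have lookup_y: "Poly_Mapping.lookup y = v"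
    by (simp add: y_def)
  have "\<delta> (?e g) = y * \<tau> (?e g) - \<sigma> (?e g) * y" for g
  proof (rule poly_mapping_eqI)
    fix x
    \<comment> \<open>At \<open>x - \<psi> g\<close> the coboundary is
      \<open>v (x - \<psi> g) - v (- \<phi> g + x)\<close>, whose terms are the coefficients of
      \<open>y * \<tau> (?e g)\<close> and \<open>\<sigma> (?e g) * y\<close> at
      \<open>x\<close>.\<close>
    have "Poly_Mapping.lookup (\<delta> (?e g)) x = c g (x - \<psi> g)"
      by (simp add: c_def)
    then show "Poly_Mapping.lookup (\<delta> (?e g)) x
        = Poly_Mapping.lookup (y * \<tau> (?e g) - \<sigma> (?e g) * y) x"
      by (simp add: v act_def \<sigma>_e \<tau>_e lookup_minus lookup_single_times lookup_times_single
          lookup_y add_diff_eq[symmetric] add.assoc)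
  qed
  with \<phi> \<psi> \<delta> show ?thesis
    by (intro twisted_inner_if_on_group) (auto simp: linear_extension_def twisted_derivation_def)
qed

theorem theorem1p1:
  fixes p :: nat
  assumes "CHAR('r::idom) = p"
    and "\<not> p dvd CARD('g::{group_add,finite})"
  shows "(is_field TYPE('r) \<longrightarrow>
      (\<forall>\<sigma> \<tau> :: ('g \<Rightarrow>\<^sub>0 'r) \<Rightarrow> ('g \<Rightarrow>\<^sub>0 'r).
        algebra_endo gr_scale \<sigma> \<and> algebra_endo gr_scale \<tau> \<and>
        (\<forall>z\<in>center. \<sigma> z = z) \<and> (\<forall>z\<in>center. \<tau> z = z) \<longrightarrow>
        (\<forall>\<delta>. twisted_derivation gr_scale \<sigma> \<tau> \<delta> \<longrightarrow> twisted_inner \<sigma> \<tau> \<delta>)))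
    \<and> (\<not> is_field TYPE('r) \<longrightarrow>
      (\<forall>\<sigma> \<tau> :: ('g \<Rightarrow>\<^sub>0 'r) \<Rightarrow> ('g \<Rightarrow>\<^sub>0 'r).
        (\<exists>\<phi>. group_endo \<phi> \<and> linear_extension \<phi> \<sigma>) \<and>
        (\<exists>\<psi>. group_endo \<psi> \<and> linear_extension \<psi> \<tau>) \<and>
        (\<forall>z\<in>center. \<sigma> z = z) \<and> (\<forall>z\<in>center. \<tau> z = z) \<longrightarrow>
        (\<forall>\<delta>. twisted_derivation gr_scale \<sigma> \<tau> \<delta> \<longrightarrow> twisted_inner \<sigma> \<tau> \<delta>)))"
proof -
  \<comment> \<open>For \<open>p = 0\<close> this holds too, since 0 divides only 0 and the group is
    nonempty.\<close>
  have card: "of_nat CARD('g) \<noteq> (0 :: 'r)"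
    using assms by (simp add: of_nat_eq_0_iff_char_dvd)
  \<comment> \<open>Fixing the center thus yields \<open>\<tau> 1 = 1\<close>, which
    \<open>algebra_endo\<close> does not include.\<close>
  have one: "1 \<in> (center :: ('g \<Rightarrow>\<^sub>0 'r) set)"
    by (simp add: center_def)
  show ?thesis
  proof (intro conjI impI allI)
    fix \<sigma> \<tau> \<delta> :: "('g \<Rightarrow>\<^sub>0 'r) \<Rightarrow> ('g \<Rightarrow>\<^sub>0 'r)"
    assume "is_field TYPE('r)"
    with card obtain b where "of_nat CARD('g) * b = (1 :: 'r)"
      unfolding is_field_def by blast
    moreover assume "algebra_endo gr_scale \<sigma> \<and> algebra_endo gr_scale \<tau> \<and>
      (\<forall>z\<in>center. \<sigma> z = z) \<and> (\<forall>z\<in>center. \<tau> z = z)"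
      and "twisted_derivation gr_scale \<sigma> \<tau> \<delta>"
    ultimately show "twisted_inner \<sigma> \<tau> \<delta>"
      using one by (intro twisted_inner_if_card_unit) auto
  next
    fix \<sigma> \<tau> \<delta> :: "('g \<Rightarrow>\<^sub>0 'r) \<Rightarrow> ('g \<Rightarrow>\<^sub>0 'r)"
    assume "(\<exists>\<phi>. group_endo \<phi> \<and> linear_extension \<phi> \<sigma>) \<and>
      (\<exists>\<psi>. group_endo \<psi> \<and> linear_extension \<psi> \<tau>) \<and>
      (\<forall>z\<in>center. \<sigma> z = z) \<and> (\<forall>z\<in>center. \<tau> z = z)"
      and "twisted_derivation gr_scale \<sigma> \<tau> \<delta>"
    with card show "twisted_inner \<sigma> \<tau> \<delta>"
      using twisted_inner_if_linear_extension by blast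
  qed
qed

end
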